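(* Let $(\mathcal{X},d_{\mathcal{X}})$ be a finite metric space with $d_{\mathcal{X}}\le 1$, let $\|\cdot\|$ be a norm on $\mathbb{R}^d$, let $f:\mathcal{X}\to\mathbb{R}^d$ be $\ell$-Lipschitz ($\|f(x)-f(x')\|\le\ell\,d_{\mathcal{X}}(x,x')$) with $\ell>0$, and let $q_f(K)=\mathbb{E}_{x\sim\tilde K}[f(x)]$. For $\omega>0$ let $\mathcal{M}_\omega$ be the mechanism which on input a dataset $K$ outputs $$q_f(K)+\ell\, g\, U,$$ where $U$ is uniform on the unit sphere $\{x\in\mathbb{R}^d:\|x\|=1\}$ and, independently, $g$ is Gamma distributed with shape $d$ and scale $\omega$. Then for every $\alpha>0$: 1. $\mathcal{M}_{\omega}$ with $\omega=\frac1\alpha$ satisfies $(\alpha,0)$-unbounded local $d_{\mathsf{EM}}$-DP. 2. $\mathcal{M}_{\omega}$ with $\omega=\frac{1}{\alpha n}$, applied to the global dataset $K_G$ of $n$ users, satisfies $(\alpha,0)$-bounded central $d_{\mathsf{EM}}$-DP.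
   Context: A dataset $K$ is a nonempty finite multiset of elements of $\mathcal{X}$; $\tilde K$ is its empirical distribution, $\tilde K[x]=(\text{number of occurrences of }x\text{ in }K)/|K|$. The earth-mover's distance is $d_{\mathsf{EM}}(P,Q)=\inf_{C}\mathbb{E}_{(x,x')\sim C}[d_{\mathcal{X}}(x,x')]$ over couplings $C$ of $P,Q$. "Uniform on the unit sphere" means the law of $Z/\|Z\|$ for $Z$ uniform (Lebesgue) on the unit ball $\{\|x\|\le1\}$ (cone measure), so that $gU$ has density proportional to $e^{-\|x\|/\omega}$. $(\alpha,\delta)$-unbounded local $d_{\mathsf{EM}}$-DP: for all datasets $K,K'$ (of any sizes) and all measurable output sets $O$, $\Pr[\mathcal{M}(K)\in O]\le e^{\alpha d_{\mathsf{EM}}(\tilde K,\tilde K')}\Pr[\mathcal{M}(K')\in O]+\delta$. $(\alpha,\delta)$-bounded central $d_{\mathsf{EM}}$-DP: there are $n$ users, user $i$ holds $K_i\in\mathcal{X}^m$ (a multiset of fixed public size $m$), and $K_G=K_1\cup\dots\cup K_n$ (multiset union). For all $K_G,K_G'$ where $K_G'$ is obtained from $K_G$ by replacing a single user's dataset $K_i$ by $K_i'\in\mathcal{X}^m$, and all measurable $O$, $\Pr[\mathcal{M}(K_G)\in O]\le e^{\alpha d_{\mathsf{EM}}(\tilde K_i,\tilde K_i')}\Pr[\mathcal{M}(K_G')\in O]+\delta$. *)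

theory Defs
  imports "HOL-Probability.Probability"
begin

definition datasets :: "'x set \<Rightarrow> 'x multiset set" where
  "datasets X = {K. K \<noteq> {#} \<and> set_mset K \<subseteq> X}"

(* For nonempty K, pmf_of_multiset K is the empirical distribution
   x |-> count K x / size K. *)
abbreviation empirical :: "'x multiset \<Rightarrow> 'x pmf" where
  "empirical K \<equiv> pmf_of_multiset K"

definition couplings :: "'x pmf \<Rightarrow> 'x pmf \<Rightarrow> ('x \<times> 'x) pmf set" where
  "couplings P Q = {C. map_pmf fst C = P \<and> map_pmf snd C = Q}"

definition emd :: "('x \<Rightarrow> 'x \<Rightarrow> real) \<Rightarrow> 'x pmf \<Rightarrow> 'x pmf \<Rightarrow> real" where
  "emd dX P Q =
     (INF C\<in>couplings P Q. measure_pmf.expectation C (\<lambda>(x, x'). dX x x'))"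

definition mean_query :: "('x \<Rightarrow> 'v::euclidean_space) \<Rightarrow> 'x multiset \<Rightarrow> 'v" where
  "mean_query f K = measure_pmf.expectation (empirical K) f"

(* An arbitrary norm, unrelated to the Euclidean norm of the type.
   Nonnegativity follows from the triangle inequality and homogeneity. *)
definition is_norm :: "('v::real_vector \<Rightarrow> real) \<Rightarrow> bool" where
  "is_norm N \<longleftrightarrow>
     (\<forall>x. N x = 0 \<longleftrightarrow> x = 0) \<and>
     (\<forall>c x. N (c *\<^sub>R x) = \<bar>c\<bar> * N x) \<and>
     (\<forall>x y. N (x + y) \<le> N x + N y)"

(* The cone measure: the law of Z / N Z for Z uniform on the closed unit ball of N.
   The value at the null event Z = 0 is irrelevant. *)
definition uniform_sphere :: "('v::euclidean_space \<Rightarrow> real) \<Rightarrow> 'v measure" where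
  "uniform_sphere N =
     distr (uniform_measure lborel {z. N z \<le> 1}) borel (\<lambda>z. (1 / N z) *\<^sub>R z)"

definition gamma_density :: "real \<Rightarrow> real \<Rightarrow> real \<Rightarrow> real" where
  "gamma_density k \<theta> x =
     (if x \<le> 0 then 0
      else x powr (k - 1) * exp (- x / \<theta>) / (Gamma k * \<theta> powr k))"

definition gamma_distr :: "real \<Rightarrow> real \<Rightarrow> real measure" where
  "gamma_distr k \<theta> = density lborel (\<lambda>x. ennreal (gamma_density k \<theta> x))"

(* A mechanism is represented by its output laws: M K is the law of the output on input K.
   Independence of U and g is expressed by the product measure. *)
definition sphere_gamma_mechanism ::
  "('v::euclidean_space \<Rightarrow> real) \<Rightarrow> ('x \<Rightarrow> 'v) \<Rightarrow> real \<Rightarrow> real \<Rightarrow> 'x multiset \<Rightarrow> 'v measure" where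
  "sphere_gamma_mechanism N f L \<omega> K =
     distr (uniform_sphere N \<Otimes>\<^sub>M gamma_distr (real DIM('v)) \<omega>) borel
       (\<lambda>(u, g). mean_query f K + (L * g) *\<^sub>R u)"

(* Required in both privacy notions below, so that the quantities measure (M K) S
   are genuine probabilities on the output space Y. *)
definition randomized_mechanism :: "'x set \<Rightarrow> 'y measure \<Rightarrow> ('x multiset \<Rightarrow> 'y measure) \<Rightarrow> bool" where
  "randomized_mechanism X Y M \<longleftrightarrow> (\<forall>K\<in>datasets X. prob_space (M K) \<and> sets (M K) = sets Y)"

definition unbounded_local_emd_dp ::
  "'x set \<Rightarrow> ('x \<Rightarrow> 'x \<Rightarrow> real) \<Rightarrow> 'y measure \<Rightarrow> real \<Rightarrow> real \<Rightarrow> ('x multiset \<Rightarrow> 'y measure) \<Rightarrow> bool" where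
  "unbounded_local_emd_dp X dX Y \<alpha> \<delta> M \<longleftrightarrow>
     randomized_mechanism X Y M \<and>
     (\<forall>K\<in>datasets X. \<forall>K'\<in>datasets X. \<forall>S\<in>sets Y.
        measure (M K) S
          \<le> exp (\<alpha> * emd dX (empirical K) (empirical K')) * measure (M K') S + \<delta>)"

(* Users are indexed by {..<n}; user i holds Ks i, and Ks(j := K') replaces the data of
   user j. The sum of multisets is the multiset union. *)
definition bounded_central_emd_dp ::
  "nat \<Rightarrow> nat \<Rightarrow> 'x set \<Rightarrow> ('x \<Rightarrow> 'x \<Rightarrow> real) \<Rightarrow> 'y measure \<Rightarrow> real \<Rightarrow> real \<Rightarrow> ('x multiset \<Rightarrow> 'y measure) \<Rightarrow> bool" where
  "bounded_central_emd_dp n m X dX Y \<alpha> \<delta> M \<longleftrightarrow>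
     randomized_mechanism X Y M \<and>
     (\<forall>Ks j K'.
        (\<forall>i<n. Ks i \<in> datasets X \<and> size (Ks i) = m) \<and>
        j < n \<and> K' \<in> datasets X \<and> size K' = m \<longrightarrow>
        (\<forall>S\<in>sets Y.
           measure (M (\<Sum>i<n. Ks i)) S
             \<le> exp (\<alpha> * emd dX (empirical (Ks j)) (empirical K'))
                 * measure (M (\<Sum>i<n. (Ks(j := K')) i)) S + \<delta>))"

end

theory Submission
  imports Defs
begin

text \<open>
  The noise \<open>g U\<close> has density proportional to \<open>exp (- N x / \<omega>)\<close>. No polar decomposition is
  needed for this: with \<open>U = z / N z\<close> and \<open>z\<close> uniform on the unit ball of \<open>N\<close>, one substitutes
  \<open>g = t * N z\<close>, exchanges the integrals over \<open>t\<close> and \<open>z\<close>, substitutes \<open>x = t z\<close> and integrates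
  out \<open>t \<ge> N x\<close>, which turns the Gamma density into the exponential.
  By the triangle inequality, shifting the noise by \<open>a\<close> changes the density at most by the factor
  \<open>exp (N a / \<omega>)\<close>. The shift of the query is at most \<open>L\<close> times the earth-mover's distance, since
  for every coupling the difference of the means is the mean of the differences. In the central
  model, replacing one of \<open>n\<close> users of equal size scales the shift by \<open>1 / n\<close>.
\<close>

section \<open>Norms on a Euclidean space: continuity and the unit ball\<close>

lemma is_norm_zero: "is_norm N \<Longrightarrow> N 0 = 0"
  by (simp add: is_norm_def)

lemma is_norm_scaleR: "is_norm N \<Longrightarrow> N (c *\<^sub>R x) = \<bar>c\<bar> * N x"
  by (simp add: is_norm_def)

lemma is_norm_triangle: "is_norm N \<Longrightarrow> N (x + y) \<le> N x + N y"
  by (simp add: is_norm_def)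

lemma is_norm_nonneg:
  assumes "is_norm N"
  shows "N x \<ge> 0"
proof -
  have "N (- x) = N x"
    using is_norm_scaleR[OF assms, of "-1" x] by simp
  then show ?thesis
    using is_norm_triangle[OF assms, of x "- x"] by (simp add: is_norm_zero[OF assms])
qed

lemma is_norm_pos: "is_norm N \<Longrightarrow> x \<noteq> 0 \<Longrightarrow> N x > 0"
  using is_norm_nonneg[of N x] by (auto simp: is_norm_def less_le)

lemma is_norm_sum:
  assumes "is_norm N"
  shows "N (\<Sum>i\<in>A. g i) \<le> (\<Sum>i\<in>A. N (g i))"
proof (induction A rule: infinite_finite_induct)
  case (insert i A)
  then show ?case
    using is_norm_triangle[OF assms, of "g i" "sum g A"] by simp
qed (simp_all add: is_norm_zero[OF assms])

text \<open>Expand \<open>x\<close> in \<open>Basis\<close> and bound each coordinate by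
  \<open>norm x\<close>. This comparison with the Euclidean norm makes \<open>N\<close> Lipschitz,
  hence continuous and Borel measurable.\<close>

lemma is_norm_le_norm:
  fixes N :: "'v::euclidean_space \<Rightarrow> real"
  assumes "is_norm N"
  shows "N x \<le> (\<Sum>b\<in>Basis. N b) * norm x"
proof -
  have "N x = N (\<Sum>b\<in>Basis. (x \<bullet> b) *\<^sub>R b)"
    by (simp add: euclidean_representation)
  also have "\<dots> \<le> (\<Sum>b\<in>Basis. \<bar>x \<bullet> b\<bar> * N b)"
    using is_norm_sum[OF assms] by (metis (no_types, lifting) assms is_norm_scaleR sum.cong)
  also have "\<dots> \<le> (\<Sum>b\<in>Basis. norm x * N b)"
    by (intro sum_mono mult_right_mono Basis_le_norm is_norm_nonneg assms)
  finally show ?thesis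
    by (simp add: sum_distrib_left mult.commute)
qed

lemma is_norm_continuous_on:
  fixes N :: "'v::euclidean_space \<Rightarrow> real"
  assumes "is_norm N"
  shows "continuous_on A N"
proof -
  define B where "B = (\<Sum>b\<in>Basis. N b)"
  have "B \<ge> 0"
    unfolding B_def by (intro sum_nonneg is_norm_nonneg assms)
  have le: "N x - N y \<le> B * dist x y" for x y
    using is_norm_triangle[OF assms, of "x - y" y] is_norm_le_norm[OF assms, of "x - y"]
    by (simp add: B_def dist_norm)
  have "B-lipschitz_on A N"
  proof (rule lipschitz_onI)
    show "dist (N x) (N y) \<le> B * dist x y" for x y
      using le[of x y] le[of y x] by (simp add: dist_real_def dist_commute abs_le_iff)
  qed fact
  then show ?thesis
    by (rule lipschitz_on_continuous_on)
qed

lemma is_norm_measurable: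
  fixes N :: "'v::euclidean_space \<Rightarrow> real"
  assumes "is_norm N"
  shows "N \<in> borel_measurable borel"
  by (intro borel_measurable_continuous_onI is_norm_continuous_on assms)

text \<open>By compactness \<open>N\<close> attains a positive minimum \<open>N u\<close> on the
  Euclidean unit sphere, and homogeneity turns this into \<open>N u * norm x \<le> N x\<close> for
  every \<open>x\<close>.\<close>

lemma bounded_is_norm_ball:
  fixes N :: "'v::euclidean_space \<Rightarrow> real"
  assumes "is_norm N"
  shows "bounded {z. N z \<le> 1}"
proof -
  have "compact (sphere 0 1 :: 'v set)" "sphere 0 1 \<noteq> ({} :: 'v set)"
    by auto
  then obtain u :: 'v where u: "u \<in> sphere 0 1" and min: "\<forall>y\<in>sphere 0 1. N u \<le> N y"
    using continuous_attains_inf is_norm_continuous_on[OF assms] by metis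
  have pos: "N u > 0"
    using u by (intro is_norm_pos assms) auto
  have "norm x \<le> 1 / N u" if "N x \<le> 1" for x
  proof (cases "x = 0")
    case False
    then have "N u \<le> N ((1 / norm x) *\<^sub>R x)"
      using min by simp
    then have "N u * norm x \<le> N x"
      using False by (simp add: is_norm_scaleR[OF assms] field_simps)
    then show ?thesis
      using pos that by (simp add: field_simps)
  qed (use pos in auto)
  then show ?thesis
    by (auto intro!: boundedI)
qed

lemma emeasure_is_norm_ball_finite:
  fixes N :: "'v::euclidean_space \<Rightarrow> real"
  assumes "is_norm N"
  shows "emeasure lborel {z. N z \<le> 1} < \<infinity>"
  by (intro emeasure_bounded_finite bounded_is_norm_ball assms)

text \<open>By continuity of \<open>N\<close> the ball contains a Euclidean ball around 0, which has
  positive volume.\<close>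

lemma emeasure_is_norm_ball_nonzero:
  fixes N :: "'v::euclidean_space \<Rightarrow> real"
  assumes "is_norm N"
  shows "emeasure lborel {z. N z \<le> 1} \<noteq> 0"
proof -
  note [measurable] = is_norm_measurable[OF assms]
  have "open {z. N z < 1}"
    using is_norm_continuous_on[OF assms] by (intro open_Collect_less) auto
  moreover have "0 \<in> {z. N z < 1}"
    by (simp add: is_norm_zero[OF assms])
  ultimately obtain e where e: "e > 0" "ball 0 e \<subseteq> {z. N z < 1}"
    by (meson open_contains_ball)
  have "0 < emeasure lborel (ball (0::'v) e)"
    using e content_ball_pos[of e "0::'v"] by (simp add: emeasure_lborel_ball_finite measure_def enn2real_positive_iff)
  also have "\<dots> \<le> emeasure lborel {z. N z \<le> 1}"
    using e by (intro emeasure_mono) auto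
  finally show ?thesis by simp
qed

section \<open>Radial integration\<close>

text \<open>Serves two substitutions: a pure dilation in the radial identity, and a pure translation
  (\<open>c = 1\<close>) when the noise is shifted.\<close>

lemma nn_integral_lborel_affine:
  fixes t :: "'v::euclidean_space"
  assumes [measurable]: "\<phi> \<in> borel_measurable borel" and "c \<noteq> 0"
  shows "(\<integral>\<^sup>+x. \<phi> x \<partial>lborel) =
           ennreal (\<bar>c\<bar> ^ DIM('v)) * (\<integral>\<^sup>+x. \<phi> (t + c *\<^sub>R x) \<partial>lborel)"
  by (subst lborel_affine[OF assms(2), of t])
     (simp add: nn_integral_density nn_integral_distr nn_integral_cmult)

text \<open>The antiderivative \<open>- 1 / (d * t ^ d)\<close> vanishes at infinity because
  \<open>d > 0\<close>. The exponent \<open>Suc d\<close> is the one that the substitution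
  \<open>x = t z\<close> produces: \<open>d\<close> from the Jacobian and one more from
  \<open>N z = N x / t\<close>.\<close>

lemma nn_integral_inverse_power_tail:
  assumes "a > 0" "d > 0"
  shows "(\<integral>\<^sup>+t. ennreal (1 / t ^ Suc d) * indicator {a..} t \<partial>lborel) =
           ennreal (1 / (real d * a ^ d))"
proof -
  have "(\<integral>\<^sup>+t. ennreal (1 / t ^ Suc d) * indicator {a..} t \<partial>lborel) =
          ennreal (0 - (- 1 / (real d * a ^ d)))"
  proof (rule nn_integral_FTC_atLeast)
    show "((\<lambda>t. - 1 / (real d * t ^ d)) has_field_derivative 1 / x ^ Suc d) (at x)"
      if "a \<le> x" for x
    proof -
      have [simp]: "x > 0" "x \<noteq> 0" using that assms by auto
      have "x ^ d = x * x ^ (d - 1)" using assms by (metis power_minus_mult mult.commute)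
      then show ?thesis using assms
        by (auto intro!: derivative_eq_intros simp: field_simps)
    qed
    have "((\<lambda>t::real. 1 / t ^ d) \<longlongrightarrow> 0) at_top"
      using assms by (intro real_tendsto_divide_at_top[OF tendsto_const] filterlim_pow_at_top filterlim_ident) auto
    from tendsto_mult_right[OF this, of "- 1 / real d"]
    show "((\<lambda>t. - 1 / (real d * t ^ d)) \<longlongrightarrow> 0) at_top"
      by (simp add: field_simps)
  qed (use assms in auto)
  then show ?thesis by simp
qed

text \<open>The left side integrates \<open>\<phi>\<close> at the point with direction
  \<open>z / N z\<close> and radius \<open>r\<close>, weighted by \<open>k r\<close>; the right side
  exhibits the resulting density in \<open>x\<close>. Its last factor is \<open>N x\<close> to the
  power \<open>1 - d\<close>, divided by \<open>d\<close>, where \<open>d\<close> is the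
  dimension.\<close>

lemma nn_integral_radial:
  fixes N :: "'v::euclidean_space \<Rightarrow> real" and k :: "real \<Rightarrow> ennreal" and \<phi> :: "'v \<Rightarrow> ennreal"
  assumes N: "is_norm N"
    and [measurable]: "k \<in> borel_measurable borel" "\<phi> \<in> borel_measurable borel"
    and k0: "\<And>r. r \<le> 0 \<Longrightarrow> k r = 0"
  shows "(\<integral>\<^sup>+z. indicator {z. N z \<le> 1} z * (\<integral>\<^sup>+r. k r * \<phi> ((r / N z) *\<^sub>R z) \<partial>lborel) \<partial>lborel) =
           (\<integral>\<^sup>+x. k (N x) * \<phi> x * ennreal (N x / (real DIM('v) * N x ^ DIM('v))) \<partial>lborel)"
proof -
  note [measurable] = is_norm_measurable[OF N]
  let ?d = "DIM('v)"
  \<comment> \<open>\<open>G\<close> is the integrand after \<open>r = N z * t\<close>, with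
    Jacobian \<open>N z\<close>. \<open>H\<close> is what \<open>x = t z\<close> makes of it: the
    constraint \<open>N z \<le> 1\<close> becomes \<open>N x \<le> t\<close>, and \<open>N z\<close>
    times the Jacobian \<open>1 / t ^ d\<close> becomes \<open>N x / t ^ Suc d\<close>.\<close>
  define G where
    "G t z = (if N z \<le> 1 then ennreal (N z) * (k (N z * t) * \<phi> (t *\<^sub>R z)) else 0)" for t z
  define H where
    "H t x = (if N x \<le> t then k (N x) * \<phi> x * (ennreal (N x) * ennreal (1 / t ^ Suc ?d)) else 0)" for t x
  have [measurable]: "(\<lambda>(z, t). G t z) \<in> borel_measurable (borel \<Otimes>\<^sub>M borel)"
    "(\<lambda>(t, x). H t x) \<in> borel_measurable (borel \<Otimes>\<^sub>M borel)"
    unfolding G_def H_def by (measurable)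
  have inner: "indicator {z. N z \<le> 1} z * (\<integral>\<^sup>+r. k r * \<phi> ((r / N z) *\<^sub>R z) \<partial>lborel) =
      (\<integral>\<^sup>+t. G t z \<partial>lborel)" if "z \<noteq> 0" for z
  proof -
    have Nz: "N z > 0" by (intro is_norm_pos N that)
    have "(\<integral>\<^sup>+r. k r * \<phi> ((r / N z) *\<^sub>R z) \<partial>lborel) =
        ennreal (N z) * (\<integral>\<^sup>+t. k (N z * t) * \<phi> (t *\<^sub>R z) \<partial>lborel)"
      using Nz by (subst nn_integral_real_affine[of _ "N z" 0]) (auto simp: abs_of_pos)
    then show ?thesis
      unfolding G_def by (cases "N z \<le> 1") (simp_all add: nn_integral_cmult)
  qed
  \<comment> \<open>The dilation is invertible only for nonzero \<open>t\<close>. For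
    \<open>t \<le> 0\<close> the argument \<open>N z * t\<close> is nonpositive, so \<open>k\<close>
    kills the left side.\<close>
  have scale: "(\<integral>\<^sup>+z. G t z \<partial>lborel) = indicator {0<..} t * (\<integral>\<^sup>+x. H t x \<partial>lborel)" for t
  proof (cases "t > 0")
    case True
    have eq: "H t (t *\<^sub>R z) = ennreal (1 / t ^ ?d) * G t z" for z
    proof -
      have "ennreal (t * N z) * ennreal (1 / t ^ Suc ?d) = ennreal (N z) * ennreal (1 / t ^ ?d)"
        using True is_norm_nonneg[OF N, of z] by (simp add: ennreal_mult[symmetric])
      then show ?thesis
        using True by (simp add: H_def G_def is_norm_scaleR[OF N] mult_ac)
    qed
    have "(\<integral>\<^sup>+x. H t x \<partial>lborel) = ennreal (t ^ ?d) * (\<integral>\<^sup>+z. H t (t *\<^sub>R z) \<partial>lborel)"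
      using True by (subst nn_integral_lborel_affine[of _ t 0]) auto
    also have "\<dots> = ennreal (t ^ ?d) * (ennreal (1 / t ^ ?d) * (\<integral>\<^sup>+z. G t z \<partial>lborel))"
      unfolding eq by (subst nn_integral_cmult) auto
    also have "\<dots> = (\<integral>\<^sup>+z. G t z \<partial>lborel)"
      using True by (simp add: mult.assoc[symmetric] ennreal_mult[symmetric])
    finally show ?thesis using True by simp
  next
    case False
    then have "G t z = 0" for z
      using is_norm_nonneg[OF N, of z] by (simp add: G_def k0 mult_nonneg_nonpos)
    then show ?thesis using False by simp
  qed
  \<comment> \<open>Since \<open>N x > 0\<close>, the condition \<open>N x \<le> t\<close> already
    implies \<open>t > 0\<close>, and what depends on \<open>t\<close> is the tail of an inverse
    power.\<close>
  have tail: "(\<integral>\<^sup>+t. indicator {0<..} t * H t x \<partial>lborel) =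
      k (N x) * \<phi> x * ennreal (N x / (real ?d * N x ^ ?d))" if "x \<noteq> 0" for x
  proof -
    have Nx: "N x > 0" by (intro is_norm_pos N that)
    have "(\<integral>\<^sup>+t. indicator {0<..} t * H t x \<partial>lborel) =
        (\<integral>\<^sup>+t. (k (N x) * \<phi> x * ennreal (N x)) * (ennreal (1 / t ^ Suc ?d) * indicator {N x..} t) \<partial>lborel)"
      using Nx by (intro nn_integral_cong) (auto simp: H_def indicator_def mult.assoc)
    also have "\<dots> = k (N x) * \<phi> x * (ennreal (N x) * ennreal (1 / (real ?d * N x ^ ?d)))"
      using Nx by (subst nn_integral_cmult) (auto simp: nn_integral_inverse_power_tail mult.assoc simp del: power_Suc)
    finally show ?thesis
      using Nx by (simp add: ennreal_mult[symmetric])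
  qed
  have "(\<integral>\<^sup>+z. indicator {z. N z \<le> 1} z * (\<integral>\<^sup>+r. k r * \<phi> ((r / N z) *\<^sub>R z) \<partial>lborel) \<partial>lborel) =
      (\<integral>\<^sup>+z. \<integral>\<^sup>+t. G t z \<partial>lborel \<partial>lborel)"
    \<comment> \<open>The substitution \<open>r = N z * t\<close> breaks down at
      \<open>z = 0\<close>, which is a null set.\<close>
    using AE_lborel_singleton[of "0::'v"] by (intro nn_integral_cong_AE) (auto simp: inner)
  also have "\<dots> = (\<integral>\<^sup>+t. \<integral>\<^sup>+z. G t z \<partial>lborel \<partial>lborel)"
    by (rule lborel_pair.Fubini') simp
  also have "\<dots> = (\<integral>\<^sup>+t. \<integral>\<^sup>+x. indicator {0<..} t * H t x \<partial>lborel \<partial>lborel)"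
    by (simp add: scale nn_integral_cmult)
  also have "\<dots> = (\<integral>\<^sup>+x. \<integral>\<^sup>+t. indicator {0<..} t * H t x \<partial>lborel \<partial>lborel)"
    by (rule lborel_pair.Fubini') measurable
  also have "\<dots> = (\<integral>\<^sup>+x. k (N x) * \<phi> x * ennreal (N x / (real ?d * N x ^ ?d)) \<partial>lborel)"
    using AE_lborel_singleton[of "0::'v"] by (intro nn_integral_cong_AE) (auto simp: tail)
  finally show ?thesis .
qed

section \<open>The Gamma and cone distributions as probability measures\<close>

lemma gamma_density_measurable [measurable]: "gamma_density k \<theta> \<in> borel_measurable borel"
  unfolding gamma_density_def by measurable

lemma gamma_density_nonneg: "k > 0 \<Longrightarrow> \<theta> > 0 \<Longrightarrow> gamma_density k \<theta> x \<ge> 0"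
  by (simp add: gamma_density_def Gamma_real_pos less_imp_le)

lemma gamma_density_of_nat:
  assumes "d > 0" "\<theta> > 0" "x > 0"
  shows "gamma_density (real d) \<theta> x = x ^ (d - 1) * exp (- x / \<theta>) / (fact (d - 1) * \<theta> ^ d)"
proof -
  have "Gamma (real d) = fact (d - 1)"
    using assms Gamma_fact[of "d - 1", where ?'a = real] by simp
  moreover have "x powr (real d - 1) = x ^ (d - 1)"
    using assms powr_realpow[of x "d - 1"] by (simp add: of_nat_diff)
  ultimately show ?thesis
    using assms by (simp add: gamma_density_def powr_realpow)
qed

text \<open>For integer shape this is the Erlang distribution with rate \<open>1 / \<theta>\<close>,
  whose parameter in \<open>erlang_density\<close> is the shape minus one.\<close>

lemma prob_space_gamma_distr_nat:
  assumes "d > 0" "\<theta> > 0"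
  shows "prob_space (gamma_distr (real d) \<theta>)"
proof -
  have "gamma_distr (real d) \<theta> = density lborel (\<lambda>x. ennreal (erlang_density (d - 1) (1 / \<theta>) x))"
    unfolding gamma_distr_def
  proof (rule density_cong)
    \<comment> \<open>The two densities may differ at 0: for \<open>d = 1\<close> the Erlang density
      is \<open>1 / \<theta>\<close> there, while \<open>gamma_density\<close> is 0.\<close>
    have "gamma_density (real d) \<theta> x = erlang_density (d - 1) (1 / \<theta>) x" if "x \<noteq> 0" for x
    proof (cases "x > 0")
      case True
      with assms show ?thesis
        by (simp add: gamma_density_of_nat erlang_density_def power_one_over field_simps)
    qed (use that in \<open>auto simp: gamma_density_def erlang_density_def\<close>)
    then show "AE x in lborel. ennreal (gamma_density (real d) \<theta> x) = ennreal (erlang_density (d - 1) (1 / \<theta>) x)"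
      using AE_lborel_singleton[of "0::real"] by auto
  qed auto
  then show ?thesis
    using assms prob_space_erlang_density[of "1 / \<theta>" "d - 1"] by simp
qed

lemma prob_space_uniform_sphere:
  fixes N :: "'v::euclidean_space \<Rightarrow> real"
  assumes "is_norm N"
  shows "prob_space (uniform_sphere N)"
proof -
  note [measurable] = is_norm_measurable[OF assms]
  have "prob_space (uniform_measure lborel {z. N z \<le> 1})"
    using emeasure_is_norm_ball_finite[OF assms] emeasure_is_norm_ball_nonzero[OF assms]
    by (intro prob_space_uniform_measure) auto
  then show ?thesis
    unfolding uniform_sphere_def by (rule prob_space.prob_space_distr) measurable
qed

lemma sets_uniform_sphere [measurable_cong]: "sets (uniform_sphere N) = sets borel"
  by (simp add: uniform_sphere_def)

lemma sets_gamma_distr [measurable_cong]: "sets (gamma_distr k \<theta>) = sets borel"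
  by (simp add: gamma_distr_def)

section \<open>The density of the noise and of the mechanism\<close>

text \<open>Apply the radial identity with the Gamma density as \<open>k\<close>. Read as a density,
  the right side also gives the normalising constant: \<open>d! * \<omega> ^ d\<close> times the
  volume of the unit ball of \<open>N\<close>, with \<open>d\<close> the dimension.\<close>

lemma nn_integral_sphere_gamma:
  fixes N :: "'v::euclidean_space \<Rightarrow> real" and \<phi> :: "'v \<Rightarrow> ennreal"
  assumes N: "is_norm N" and [measurable]: "\<phi> \<in> borel_measurable borel" and \<omega>: "\<omega> > 0"
  shows "(\<integral>\<^sup>+(u, g). \<phi> (g *\<^sub>R u) \<partial>(uniform_sphere N \<Otimes>\<^sub>M gamma_distr (real DIM('v)) \<omega>)) =
    (\<integral>\<^sup>+x. ennreal (exp (- N x / \<omega>) / (fact DIM('v) * \<omega> ^ DIM('v))) * \<phi> x \<partial>lborel) /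
      emeasure lborel {z. N z \<le> 1}"
proof -
  note [measurable] = is_norm_measurable[OF N]
  let ?d = "DIM('v)" and ?B = "{z. N z \<le> 1}"
  define k where "k r = ennreal (gamma_density (real ?d) \<omega> r)" for r
  have [measurable]: "k \<in> borel_measurable borel"
    unfolding k_def by measurable
  interpret G: prob_space "gamma_distr (real ?d) \<omega>"
    by (intro prob_space_gamma_distr_nat \<omega>) simp
  \<comment> \<open>The factor \<open>N x ^ (d - 1)\<close> of the Gamma density cancels against the
    radial factor, and \<open>d * (d - 1)! = d!\<close>.\<close>
  have density: "k (N x) * \<phi> x * ennreal (N x / (real ?d * N x ^ ?d)) =
      ennreal (exp (- N x / \<omega>) / (fact ?d * \<omega> ^ ?d)) * \<phi> x" if "x \<noteq> 0" for x
  proof -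
    have Nx: "N x > 0" by (intro is_norm_pos N that)
    have "N x ^ ?d = N x * N x ^ (?d - 1)"
      by (metis DIM_positive power_minus_mult mult.commute)
    moreover have "(fact ?d :: real) = real ?d * fact (?d - 1)"
      by (simp add: fact_reduce)
    ultimately have "gamma_density (real ?d) \<omega> (N x) * (N x / (real ?d * N x ^ ?d)) =
        exp (- N x / \<omega>) / (fact ?d * \<omega> ^ ?d)"
      using Nx \<omega> by (simp add: gamma_density_of_nat)
    then show ?thesis
      using Nx \<omega> by (simp add: k_def mult_ac ennreal_mult[symmetric] gamma_density_nonneg)
  qed
  have "(\<integral>\<^sup>+(u, g). \<phi> (g *\<^sub>R u) \<partial>(uniform_sphere N \<Otimes>\<^sub>M gamma_distr (real ?d) \<omega>)) =
      (\<integral>\<^sup>+u. \<integral>\<^sup>+g. \<phi> (g *\<^sub>R u) \<partial>gamma_distr (real ?d) \<omega> \<partial>uniform_sphere N)"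
    by (subst G.nn_integral_fst[symmetric]) auto
  also have "\<dots> = (\<integral>\<^sup>+u. \<integral>\<^sup>+r. k r * \<phi> (r *\<^sub>R u) \<partial>lborel \<partial>uniform_sphere N)"
    by (simp add: gamma_distr_def nn_integral_density k_def)
  \<comment> \<open>Unfolding the cone measure replaces \<open>u\<close> by \<open>z / N z\<close>
    with \<open>z\<close> uniform on the ball.\<close>
  also have "\<dots> = (\<integral>\<^sup>+z. indicator ?B z * (\<integral>\<^sup>+r. k r * \<phi> ((r / N z) *\<^sub>R z) \<partial>lborel) \<partial>lborel) /
      emeasure lborel ?B"
    unfolding uniform_sphere_def
    by (subst nn_integral_distr) (auto simp: nn_integral_uniform_measure mult.commute)
  also have "(\<integral>\<^sup>+z. indicator ?B z * (\<integral>\<^sup>+r. k r * \<phi> ((r / N z) *\<^sub>R z) \<partial>lborel) \<partial>lborel) =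
      (\<integral>\<^sup>+x. k (N x) * \<phi> x * ennreal (N x / (real ?d * N x ^ ?d)) \<partial>lborel)"
    by (intro nn_integral_radial N) (auto simp: k_def gamma_density_def)
  also have "\<dots> = (\<integral>\<^sup>+x. ennreal (exp (- N x / \<omega>) / (fact ?d * \<omega> ^ ?d)) * \<phi> x \<partial>lborel)"
    using AE_lborel_singleton[of "0::'v"] by (intro nn_integral_cong_AE) (auto simp: density)
  finally show ?thesis .
qed

lemma prob_space_sphere_gamma_mechanism:
  fixes N :: "'v::euclidean_space \<Rightarrow> real"
  assumes "is_norm N" "\<omega> > 0"
  shows "prob_space (sphere_gamma_mechanism N f L \<omega> K)"
proof -
  interpret U: prob_space "uniform_sphere N"
    by (rule prob_space_uniform_sphere) fact
  interpret G: prob_space "gamma_distr (real DIM('v)) \<omega>"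
    by (intro prob_space_gamma_distr_nat assms) simp
  interpret UG: pair_prob_space "uniform_sphere N" "gamma_distr (real DIM('v)) \<omega>" ..
  show ?thesis
    unfolding sphere_gamma_mechanism_def by (rule UG.prob_space_distr) measurable
qed

text \<open>The integration variable remains the noise before scaling by \<open>L\<close>, so the
  weight is the same for all inputs and only the argument of the indicator depends on
  \<open>K\<close>.\<close>

lemma emeasure_sphere_gamma_mechanism:
  fixes N :: "'v::euclidean_space \<Rightarrow> real"
  assumes "is_norm N" "\<omega> > 0" and [measurable]: "S \<in> sets borel"
  shows "emeasure (sphere_gamma_mechanism N f L \<omega> K) S =
    (\<integral>\<^sup>+x. ennreal (exp (- N x / \<omega>) / (fact DIM('v) * \<omega> ^ DIM('v))) *
        indicator S (mean_query f K + L *\<^sub>R x) \<partial>lborel) / emeasure lborel {z. N z \<le> 1}"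
proof -
  let ?M = "uniform_sphere N \<Otimes>\<^sub>M gamma_distr (real DIM('v)) \<omega>"
  have "emeasure (sphere_gamma_mechanism N f L \<omega> K) S =
      (\<integral>\<^sup>+y. indicator S y \<partial>sphere_gamma_mechanism N f L \<omega> K)"
    by (simp add: sphere_gamma_mechanism_def)
  also have "\<dots> = (\<integral>\<^sup>+(u, g). indicator S (mean_query f K + L *\<^sub>R (g *\<^sub>R u)) \<partial>?M)"
    unfolding sphere_gamma_mechanism_def
    by (subst nn_integral_distr) (auto simp: case_prod_unfold)
  also have "\<dots> = (\<integral>\<^sup>+x. ennreal (exp (- N x / \<omega>) / (fact DIM('v) * \<omega> ^ DIM('v))) *
      indicator S (mean_query f K + L *\<^sub>R x) \<partial>lborel) / emeasure lborel {z. N z \<le> 1}"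
    using assms by (intro nn_integral_sphere_gamma) auto
  finally show ?thesis .
qed

text \<open>Couple the two runs by a shift of the noise that makes their outputs equal; the triangle
  inequality bounds the ratio of the noise densities.\<close>

lemma sphere_gamma_mechanism_emeasure_le:
  fixes N :: "'v::euclidean_space \<Rightarrow> real"
  assumes N: "is_norm N" and \<omega>: "\<omega> > 0" and L: "L > 0" and [measurable]: "S \<in> sets borel"
  shows "emeasure (sphere_gamma_mechanism N f L \<omega> K) S \<le>
    ennreal (exp (N (mean_query f K - mean_query f K') / (L * \<omega>))) *
      emeasure (sphere_gamma_mechanism N f L \<omega> K') S"
proof -
  note [measurable] = is_norm_measurable[OF N]
  define v v' where "v = mean_query f K" and "v' = mean_query f K'"
  \<comment> \<open>Chosen so that noise \<open>a + x\<close> on input \<open>K\<close> and noise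
    \<open>x\<close> on input \<open>K'\<close> give the same output.\<close>
  define a where "a = (1 / L) *\<^sub>R (v' - v)"
  define c where "c = fact DIM('v) * \<omega> ^ DIM('v)"
  define w where "w x = ennreal (exp (- N x / \<omega>) / c)" for x
  have c: "c > 0" using \<omega> by (simp add: c_def)
  have [measurable]: "w \<in> borel_measurable borel"
    unfolding w_def by measurable
  have Na: "N (- a) = N (v - v') / L"
    using is_norm_scaleR[OF N, of "1 / L" "v - v'"] L
    by (simp add: a_def flip: scaleR_minus_right)
  have w_le: "w (a + x) \<le> ennreal (exp (N (v - v') / (L * \<omega>))) * w x" for x
  proof -
    have "N x \<le> N (a + x) + N (v - v') / L"
      using is_norm_triangle[OF N, of "a + x" "- a"] by (simp add: Na)
    then have "- N (a + x) / \<omega> \<le> (N (v - v') / L - N x) / \<omega>"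
      using \<omega> by (intro divide_right_mono) auto
    also have "\<dots> = N (v - v') / (L * \<omega>) + - N x / \<omega>"
      by (simp add: diff_divide_distrib)
    finally have "exp (- N (a + x) / \<omega>) \<le> exp (N (v - v') / (L * \<omega>)) * exp (- N x / \<omega>)"
      by (simp only: exp_add[symmetric] exp_le_cancel_iff)
    then have "exp (- N (a + x) / \<omega>) / c \<le> exp (N (v - v') / (L * \<omega>)) * (exp (- N x / \<omega>) / c)"
      using c by (simp add: divide_right_mono)
    then show ?thesis
      using c by (simp add: w_def ennreal_mult[symmetric] ennreal_leI)
  qed
  have shift: "v + L *\<^sub>R (a + x) = v' + L *\<^sub>R x" for x
    using L by (simp add: a_def scaleR_add_right)
  \<comment> \<open>Translation invariance of Lebesgue measure replaces \<open>x\<close> by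
    \<open>a + x\<close>.\<close>
  have "(\<integral>\<^sup>+x. w x * indicator S (v + L *\<^sub>R x) \<partial>lborel) =
      (\<integral>\<^sup>+x. w (a + x) * indicator S (v' + L *\<^sub>R x) \<partial>lborel)"
    by (subst nn_integral_lborel_affine[of _ 1 a]) (simp_all add: shift)
  also have "\<dots> \<le> (\<integral>\<^sup>+x. ennreal (exp (N (v - v') / (L * \<omega>))) * (w x * indicator S (v' + L *\<^sub>R x)) \<partial>lborel)"
    unfolding mult.assoc[symmetric] by (intro nn_integral_mono mult_right_mono w_le) simp
  also have "\<dots> = ennreal (exp (N (v - v') / (L * \<omega>))) * (\<integral>\<^sup>+x. w x * indicator S (v' + L *\<^sub>R x) \<partial>lborel)"
    by (rule nn_integral_cmult) measurable
  finally have "(\<integral>\<^sup>+x. w x * indicator S (v + L *\<^sub>R x) \<partial>lborel) / emeasure lborel {z. N z \<le> 1} \<le>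
      ennreal (exp (N (v - v') / (L * \<omega>))) *
        ((\<integral>\<^sup>+x. w x * indicator S (v' + L *\<^sub>R x) \<partial>lborel) / emeasure lborel {z. N z \<le> 1})"
    unfolding ennreal_times_divide by (rule divide_right_mono_ennreal)
  then show ?thesis
    using N \<omega> by (simp add: emeasure_sphere_gamma_mechanism w_def c_def v_def v'_def)
qed

text \<open>Isolates what both privacy models need: a bound on the shift of the query. Taking
  \<open>\<epsilon>\<close> to be \<open>\<alpha>\<close> times the distance,
  \<open>L * \<omega> * \<epsilon>\<close> is \<open>L\<close> times the distance in the local model
  and a fraction \<open>1 / n\<close> of that in the central one.\<close>

lemma sphere_gamma_mechanism_measure_le:
  fixes N :: "'v::euclidean_space \<Rightarrow> real"
  assumes N: "is_norm N" and \<omega>: "\<omega> > 0" and L: "L > 0" and S: "S \<in> sets borel"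
    and le: "N (mean_query f K - mean_query f K') \<le> L * \<omega> * \<epsilon>"
  shows "measure (sphere_gamma_mechanism N f L \<omega> K) S \<le>
    exp \<epsilon> * measure (sphere_gamma_mechanism N f L \<omega> K') S"
proof -
  let ?M = "sphere_gamma_mechanism N f L \<omega>"
  interpret K: prob_space "?M K"
    by (rule prob_space_sphere_gamma_mechanism) fact+
  interpret K': prob_space "?M K'"
    by (rule prob_space_sphere_gamma_mechanism) fact+
  have "ennreal (measure (?M K) S) \<le>
      ennreal (exp (N (mean_query f K - mean_query f K') / (L * \<omega>)) * measure (?M K') S)"
    using sphere_gamma_mechanism_emeasure_le[OF N \<omega> L S, of f K K']
    by (simp add: K.emeasure_eq_measure K'.emeasure_eq_measure ennreal_mult[symmetric])
  then have "measure (?M K) S \<le>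
      exp (N (mean_query f K - mean_query f K') / (L * \<omega>)) * measure (?M K') S"
    by (subst (asm) ennreal_le_iff) auto
  also have "\<dots> \<le> exp \<epsilon> * measure (?M K') S"
    using le L \<omega> by (intro mult_right_mono) (auto simp: field_simps)
  finally show ?thesis .
qed

lemma randomized_mechanism_sphere_gamma:
  assumes "is_norm N" "\<omega> > 0"
  shows "randomized_mechanism X borel (sphere_gamma_mechanism N f L \<omega>)"
  using prob_space_sphere_gamma_mechanism[OF assms]
  by (auto simp: randomized_mechanism_def sphere_gamma_mechanism_def)

section \<open>Sensitivity of the mean query to the earth-mover's distance\<close>

text \<open>Both means are expectations over the marginals of \<open>C\<close>, so their difference
  is the \<open>C\<close>-mean of \<open>f x - f x'\<close>. The norm moves inside by the triangle
  inequality, and the Lipschitz bound applies on the support.\<close>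

lemma is_norm_expectation_diff_le_coupling:
  fixes f :: "'x \<Rightarrow> 'v::euclidean_space"
  assumes N: "is_norm N" and X: "finite X"
    and lip: "\<And>x x'. x \<in> X \<Longrightarrow> x' \<in> X \<Longrightarrow> N (f x - f x') \<le> L * dX x x'"
    and P: "set_pmf P \<subseteq> X" and Q: "set_pmf Q \<subseteq> X" and C: "C \<in> couplings P Q"
  shows "N (measure_pmf.expectation P f - measure_pmf.expectation Q f) \<le>
    L * measure_pmf.expectation C (\<lambda>(x, x'). dX x x')"
proof -
  have marg: "P = map_pmf fst C" "Q = map_pmf snd C"
    using C by (auto simp: couplings_def)
  then have supp: "set_pmf C \<subseteq> X \<times> X"
    using P Q by (force simp: set_map_pmf)
  \<comment> \<open>Polymorphic in the codomain: used for the vector-valued \<open>f\<close> and for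
    the real-valued cost.\<close>
  have E: "measure_pmf.expectation C h = (\<Sum>p\<in>X \<times> X. pmf C p *\<^sub>R h p)"
    for h :: "'x \<times> 'x \<Rightarrow> 'b::{banach, second_countable_topology}"
    using supp X by (intro integral_measure_pmf) auto
  have "N (measure_pmf.expectation P f - measure_pmf.expectation Q f) =
      N (\<Sum>p\<in>X \<times> X. pmf C p *\<^sub>R (f (fst p) - f (snd p)))"
    by (simp add: marg E scaleR_diff_right sum_subtractf)
  also have "\<dots> \<le> (\<Sum>p\<in>X \<times> X. pmf C p * N (f (fst p) - f (snd p)))"
    using is_norm_sum[OF N, of "\<lambda>p. pmf C p *\<^sub>R (f (fst p) - f (snd p))" "X \<times> X"]
    by (simp add: is_norm_scaleR[OF N])
  also have "\<dots> \<le> (\<Sum>p\<in>X \<times> X. pmf C p * (L * dX (fst p) (snd p)))"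
    by (intro sum_mono mult_left_mono) (auto intro: lip)
  also have "\<dots> = L * measure_pmf.expectation C (\<lambda>(x, x'). dX x x')"
    by (simp add: E sum_distrib_left mult.left_commute case_prod_unfold)
  finally show ?thesis .
qed

text \<open>After division by \<open>L > 0\<close> the left side is a lower bound for the cost of
  every coupling, hence for the infimum.\<close>

lemma is_norm_expectation_diff_le_emd:
  fixes f :: "'x \<Rightarrow> 'v::euclidean_space"
  assumes N: "is_norm N" and X: "finite X" and L: "L > 0"
    and lip: "\<And>x x'. x \<in> X \<Longrightarrow> x' \<in> X \<Longrightarrow> N (f x - f x') \<le> L * dX x x'"
    and P: "set_pmf P \<subseteq> X" and Q: "set_pmf Q \<subseteq> X"
  shows "N (measure_pmf.expectation P f - measure_pmf.expectation Q f) \<le> L * emd dX P Q"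
proof -
  \<comment> \<open>The independent coupling shows that the infimum ranges over a nonempty
    set.\<close>
  have "pair_pmf P Q \<in> couplings P Q"
    by (simp add: couplings_def map_fst_pair_pmf map_snd_pair_pmf)
  then have "N (measure_pmf.expectation P f - measure_pmf.expectation Q f) / L \<le> emd dX P Q"
    unfolding emd_def using L is_norm_expectation_diff_le_coupling[OF N X lip P Q]
    by (intro cINF_greatest) (auto simp: field_simps)
  then show ?thesis
    using L by (simp add: field_simps)
qed

lemma is_norm_mean_query_diff_le_emd:
  fixes f :: "'x \<Rightarrow> 'v::euclidean_space"
  assumes "is_norm N" "finite X" "L > 0"
    and "\<And>x x'. x \<in> X \<Longrightarrow> x' \<in> X \<Longrightarrow> N (f x - f x') \<le> L * dX x x'"
    and "K \<in> datasets X" "K' \<in> datasets X"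
  shows "N (mean_query f K - mean_query f K') \<le> L * emd dX (empirical K) (empirical K')"
  unfolding mean_query_def
  using assms by (intro is_norm_expectation_diff_le_emd[of N X]) (auto simp: datasets_def)

section \<open>Mean queries of multiset unions\<close>

text \<open>Clearing the denominator leaves a sum that is linear in the counts, hence additive under
  multiset union. The empty multiset is covered because its size is 0.\<close>

lemma scaleR_size_mean_query:
  assumes "finite X" "set_mset K \<subseteq> X"
  shows "real (size K) *\<^sub>R mean_query f K = (\<Sum>x\<in>X. real (count K x) *\<^sub>R f x)"
proof (cases "K = {#}")
  case False
  have "mean_query f K = (\<Sum>x\<in>X. pmf (empirical K) x *\<^sub>R f x)"
    unfolding mean_query_def using assms False by (intro integral_measure_pmf) auto
  then show ?thesis
    using False by (simp add: scaleR_sum_right)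
qed simp

lemma scaleR_size_mean_query_sum:
  assumes "finite X" "\<And>i. i \<in> I \<Longrightarrow> set_mset (Ks i) \<subseteq> X"
  shows "real (size (\<Sum>i\<in>I. Ks i)) *\<^sub>R mean_query f (\<Sum>i\<in>I. Ks i) =
    (\<Sum>i\<in>I. real (size (Ks i)) *\<^sub>R mean_query f (Ks i))"
proof (cases "finite I")
  case True
  have "set_mset (\<Sum>i\<in>I. Ks i) \<subseteq> X"
    using assms(2) True by (auto simp: set_mset_sum)
  then have "real (size (\<Sum>i\<in>I. Ks i)) *\<^sub>R mean_query f (\<Sum>i\<in>I. Ks i) =
      (\<Sum>x\<in>X. \<Sum>i\<in>I. real (count (Ks i) x) *\<^sub>R f x)"
    using assms(1)
    by (simp add: scaleR_size_mean_query[of X] count_sum scaleR_sum_left del: size_multiset_sum)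
  also have "\<dots> = (\<Sum>i\<in>I. real (size (Ks i)) *\<^sub>R mean_query f (Ks i))"
    using assms by (subst sum.swap) (simp add: scaleR_size_mean_query[of X])
  finally show ?thesis .
qed simp

text \<open>With equal sizes every weight in the preceding identity is \<open>m\<close>, which
  cancels because \<open>m > 0\<close>; the union then averages the users' means with equal
  weights.\<close>

lemma mean_query_sum_uniform:
  fixes Ks :: "nat \<Rightarrow> 'x multiset"
  assumes "finite X" "\<And>i. i < n \<Longrightarrow> set_mset (Ks i) \<subseteq> X"
    and size: "\<And>i. i < n \<Longrightarrow> size (Ks i) = m" and "m > 0"
  shows "real n *\<^sub>R mean_query f (\<Sum>i<n. Ks i) = (\<Sum>i<n. mean_query f (Ks i))"
proof -
  have "size (\<Sum>i<n. Ks i) = n * m"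
    by (simp add: size_multiset_sum size)
  then have "real m *\<^sub>R (real n *\<^sub>R mean_query f (\<Sum>i<n. Ks i)) = real m *\<^sub>R (\<Sum>i<n. mean_query f (Ks i))"
    using scaleR_size_mean_query_sum[of X "{..<n}" Ks f] assms
    by (simp add: scaleR_sum_right mult.commute)
  then show ?thesis
    using \<open>m > 0\<close> by (simp del: scaleR_scaleR)
qed

theorem lemma4p2:
  fixes X :: "'x set" and dX :: "'x \<Rightarrow> 'x \<Rightarrow> real"
    and N :: "real ^ 'd \<Rightarrow> real" and f :: "'x \<Rightarrow> real ^ 'd" and L :: real
  assumes "Metric_space X dX" and "finite X"
    and "\<forall>x\<in>X. \<forall>x'\<in>X. dX x x' \<le> 1"
    and "is_norm N"
    and "L > 0"
    and "\<forall>x\<in>X. \<forall>x'\<in>X. N (f x - f x') \<le> L * dX x x'"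
  shows "\<forall>\<alpha>>0.
     unbounded_local_emd_dp X dX borel \<alpha> 0 (sphere_gamma_mechanism N f L (1 / \<alpha>)) \<and>
     (\<forall>n m. n \<ge> 1 \<and> m \<ge> 1 \<longrightarrow>
        bounded_central_emd_dp n m X dX borel \<alpha> 0
          (sphere_gamma_mechanism N f L (1 / (\<alpha> * real n))))"
proof (intro allI impI conjI)
  fix \<alpha> :: real
  assume \<alpha>: "\<alpha> > 0"
  note N = \<open>is_norm N\<close> and X = \<open>finite X\<close> and L = \<open>L > 0\<close>
  have query_le: "N (mean_query f K - mean_query f K') \<le> L * emd dX (empirical K) (empirical K')"
    if "K \<in> datasets X" "K' \<in> datasets X" for K K'
    using assms that by (intro is_norm_mean_query_diff_le_emd) auto
  show "unbounded_local_emd_dp X dX borel \<alpha> 0 (sphere_gamma_mechanism N f L (1 / \<alpha>))"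
    unfolding unbounded_local_emd_dp_def
    using N L \<alpha> query_le
    by (auto intro!: randomized_mechanism_sphere_gamma sphere_gamma_mechanism_measure_le)
  fix n m :: nat
  assume nm: "n \<ge> 1 \<and> m \<ge> 1"
  let ?\<omega> = "1 / (\<alpha> * real n)"
  have \<omega>: "?\<omega> > 0"
    using \<alpha> nm by simp
  have "measure (sphere_gamma_mechanism N f L ?\<omega> (\<Sum>i<n. Ks i)) S \<le>
      exp (\<alpha> * emd dX (empirical (Ks j)) (empirical K')) *
        measure (sphere_gamma_mechanism N f L ?\<omega> (\<Sum>i<n. (Ks(j := K')) i)) S"
    if Ks: "\<forall>i<n. Ks i \<in> datasets X \<and> size (Ks i) = m" and j: "j < n"
      and K': "K' \<in> datasets X" "size K' = m" and S: "S \<in> sets borel" for Ks j K' S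
  proof (rule sphere_gamma_mechanism_measure_le[OF N \<omega> L S])
    let ?Ks' = "Ks(j := K')"
    \<comment> \<open>Both unions have \<open>n\<close> users of size \<open>m\<close>, so both
      means are plain averages, and in their difference only user \<open>j\<close>
      contributes.\<close>
    have "real n *\<^sub>R (mean_query f (\<Sum>i<n. Ks i) - mean_query f (\<Sum>i<n. ?Ks' i)) =
        (\<Sum>i<n. mean_query f (Ks i) - mean_query f (?Ks' i))"
      using Ks K' nm X mean_query_sum_uniform[of X n Ks m f] mean_query_sum_uniform[of X n ?Ks' m f]
      by (simp add: scaleR_diff_right sum_subtractf datasets_def)
    also have "\<dots> = (\<Sum>i<n. if i = j then mean_query f (Ks j) - mean_query f K' else 0)"
      by (intro sum.cong) auto
    also have "\<dots> = mean_query f (Ks j) - mean_query f K'"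
      using j by simp
    finally have "real n * N (mean_query f (\<Sum>i<n. Ks i) - mean_query f (\<Sum>i<n. ?Ks' i)) =
        N (mean_query f (Ks j) - mean_query f K')"
      by (metis N is_norm_scaleR abs_of_nat)
    also have "\<dots> \<le> L * emd dX (empirical (Ks j)) (empirical K')"
      using Ks j K' by (intro query_le) auto
    \<comment> \<open>The factor \<open>1 / n\<close> gained by averaging is exactly the one in the
      scale \<open>1 / (\<alpha> * real n)\<close>.\<close>
    finally show "N (mean_query f (\<Sum>i<n. Ks i) - mean_query f (\<Sum>i<n. ?Ks' i)) \<le>
        L * ?\<omega> * (\<alpha> * emd dX (empirical (Ks j)) (empirical K'))"
      using \<alpha> nm by (simp add: field_simps)
  qed
  then show "bounded_central_emd_dp n m X dX borel \<alpha> 0 (sphere_gamma_mechanism N f L ?\<omega>)"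
    unfolding bounded_central_emd_dp_def
    using N \<omega> by (auto intro!: randomized_mechanism_sphere_gamma)
qed

end
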